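(* Let $X$ be a $T_1$ topological space, let $\alpha$ be an uncountable ordinal, and let $f\subseteq X^2$ be a relation with $f\subseteq f\circ f$ satisfying Condition $\Gamma$. Then the Mahavier product $\mathbf{M}\langle X,f,\alpha\rangle$ contains a subspace homeomorphic to $\alpha+1$ (with its order topology); therefore, $\mathbf{M}\langle X,f,\alpha\rangle$ is not metrizable.
   Context: For a relation $f\subseteq X^2$ and $x\in X$, $f(x)=\{y\in X:\langle x,y\rangle\in f\}$, and $f\circ f$ is the relation with $(f\circ f)(x)=\bigcup_{y\in f(x)}f(y)$. A relation $f\subseteq X^2$ satisfies Condition $\Gamma$ if there exist distinct $x,y\in X$ such that $\langle x,x\rangle,\langle x,y\rangle,\langle y,y\rangle\in f$. An ordinal $\alpha=\{\beta:\beta<\alpha\}$ carries its usual linear order. The Mahavier product $\mathbf{M}\langle X,f,\alpha\rangle$ (with all factor spaces equal to $X$, bonding relations $f_{\beta,\gamma}=f$ for $\beta<\gamma<\alpha$, and $f_{\beta,\beta}$ the identity relation) is $$\mathbf{M}\langle X,f,\alpha\rangle=\{\mathbf{x}\in X^\alpha:\ \mathbf{x}(\beta)\in f(\mathbf{x}(\gamma))\text{ for all }\beta<\gamma<\alpha\},$$ with the subspace topology from the product topology on $X^\alpha$. *)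

theory Defs
  imports "HOL-Analysis.Analysis"
begin

text \<open>
  An ordinal is given by a reflexive well-order relation \<open>r\<close> with \<open>Well_order r\<close>;
  its elements are \<open>Field r\<close>, and \<open>\<beta> < \<gamma>\<close> is \<open>\<beta> \<in> underS r \<gamma>\<close>.
\<close>

definition condition_Gamma :: "'x set \<Rightarrow> 'x rel \<Rightarrow> bool" where
  "condition_Gamma X f \<longleftrightarrow>
     (\<exists>x\<in>X. \<exists>y\<in>X. x \<noteq> y \<and> (x, x) \<in> f \<and> (x, y) \<in> f \<and> (y, y) \<in> f)"

text \<open>
  Elements of \<open>X\<^sup>\<alpha>\<close> are the extensional functions of \<open>PiE\<close>, as in \<^const>\<open>product_topology\<close>.
\<close>

definition mahavier_set :: "'x set \<Rightarrow> 'x rel \<Rightarrow> 'i rel \<Rightarrow> ('i \<Rightarrow> 'x) set" where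
  "mahavier_set X f r =
     {x \<in> Field r \<rightarrow>\<^sub>E X. \<forall>\<gamma>\<in>Field r. \<forall>\<beta>\<in>underS r \<gamma>. x \<beta> \<in> f `` {x \<gamma>}}"

definition mahavier_product :: "'x topology \<Rightarrow> 'x rel \<Rightarrow> 'i rel \<Rightarrow> ('i \<Rightarrow> 'x) topology" where
  "mahavier_product X f r =
     subtopology (product_topology (\<lambda>_. X) (Field r)) (mahavier_set (topspace X) f r)"

text \<open>
  The order topology: the open rays form a subbase. The whole set is added to the subbase so
  that the one-point order, which has no nonempty rays, is covered as well.
\<close>

definition rel_order_topology :: "'i rel \<Rightarrow> 'i topology" where
  "rel_order_topology r =
     topology_generated_by (insert (Field r) (underS r ` Field r \<union> aboveS r ` Field r))"

text \<open>The ordinal successor: \<open>None\<close> is a new greatest element above a copy of \<open>r\<close>.\<close>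

definition ord_succ :: "'i rel \<Rightarrow> 'i option rel" where
  "ord_succ r = {(Some a, Some b) | a b. (a, b) \<in> r} \<union> insert None (Some ` Field r) \<times> {None}"

lemma topspace_mahavier_product:
  "topspace (mahavier_product X f r) = mahavier_set (topspace X) f r"
  by (auto simp: mahavier_product_def mahavier_set_def)

lemma topspace_rel_order_topology: "topspace (rel_order_topology r) = Field r"
  by (auto simp: rel_order_topology_def underS_def aboveS_def Field_def)

lemma Field_ord_succ: "Field (ord_succ r) = insert None (Some ` Field r)"
  by (force simp: ord_succ_def Field_def)

lemma Well_order_ord_succ:
  assumes "Well_order r"
  shows "Well_order (ord_succ r)"
proof -
  have *: "Refl r" "trans r" "antisym r" "Total r" "wf (r - Id)"
    using assms by (auto simp: order_on_defs well_order_on_def)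
  have "refl_on (Field (ord_succ r)) (ord_succ r)"
    using *(1) unfolding refl_on_def Field_ord_succ unfolding ord_succ_def by auto
  moreover have "trans (ord_succ r)"
    using *(2) unfolding trans_def ord_succ_def by (blast intro: FieldI1)
  moreover have "antisym (ord_succ r)"
    using *(3) unfolding antisym_def ord_succ_def by blast
  moreover have "total_on (Field (ord_succ r)) (ord_succ r)"
    using *(4) unfolding total_on_def Field_ord_succ unfolding ord_succ_def by blast
  moreover have "wf (ord_succ r - Id)"
  proof (rule wfUNIVI)
    fix P :: "'a option \<Rightarrow> bool" and z
    assume IH: "\<forall>x. (\<forall>y. (y, x) \<in> ord_succ r - Id \<longrightarrow> P y) \<longrightarrow> P x"
    have S: "P (Some a)" for a
      using *(5)
    proof (induction a rule: wf_induct_rule)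
      case (less a)
      then show ?case
        using IH[rule_format, of "Some a"] by (auto simp: ord_succ_def)
    qed
    moreover have "P None"
      using IH[rule_format, of None] S by (auto simp: ord_succ_def)
    ultimately show "P z"
      by (cases z) auto
  qed
  moreover have "ord_succ r \<subseteq> Field (ord_succ r) \<times> Field (ord_succ r)"
    by (auto intro: FieldI1 FieldI2)
  ultimately show ?thesis
    by (simp add: order_on_defs well_order_on_def)
qed

end

theory Submission
  imports Defs
begin

text \<open>
  Let \<open>x \<noteq> y\<close> witness Condition \<open>\<Gamma>\<close>. The step functions on \<open>\<alpha>\<close> with value \<open>y\<close> on an
  initial segment and \<open>x\<close> beyond it lie in the Mahavier product: a later value and an earlier
  one form one of the pairs \<open>(x, x)\<close>, \<open>(x, y)\<close>, \<open>(y, y)\<close>, never \<open>(y, x)\<close>. The initial segments of \<open>\<alpha>\<close> are exactly the elements of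
  \<open>\<alpha> + 1\<close>, and coordinate \<open>\<beta>\<close> of the step function at \<open>s\<close> is \<open>y\<close> if \<open>\<beta> < s\<close> and \<open>x\<close>
  if \<open>s \<le> \<beta>\<close>. In a \<open>T\<^sub>1\<close> space the two points are separated from each other by open sets, so the
  step functions carry the topology generated by the sets \<open>{s. \<beta> < s}\<close> and \<open>{s. s \<le> \<beta>}\<close>. This is
  the order topology of \<open>\<alpha> + 1\<close>: the set \<open>{s. s \<le> \<beta>}\<close> is the open ray below the successor of
  \<open>\<beta>\<close>, and conversely the open ray below \<open>t\<close> is the union of the sets \<open>{s. s \<le> \<beta>}\<close> with
  \<open>\<beta> < t\<close> (lemma \<open>step_function_embedding\<close>).

  Metrizability is hereditary, so it remains to see that \<open>\<alpha> + 1\<close> is not metrizable. As \<open>\<alpha>\<close> is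
  uncountable, there is a least \<open>t \<in> \<alpha> + 1\<close> with uncountably many predecessors (the ordinal
  \<open>\<omega>\<^sub>1\<close>). Countably many elements below \<open>t\<close> have an upper bound strictly below \<open>t\<close>, so \<open>{t}\<close> is not a
  \<open>G\<^sub>\<delta>\<close> set, while points of a metrizable space are (lemma
  \<open>not_metrizable_rel_order_topology\<close>).
\<close>

section \<open>Order topologies with a point of uncountable cofinality\<close>

lemma Well_order_cases:
  assumes "Well_order r" "a \<in> Field r" "b \<in> Field r"
  obtains "a \<in> underS r b" | "a = b" | "b \<in> underS r a"
proof -
  have "Total r"
    using assms(1) by (simp add: order_on_defs well_order_on_def)
  then have "a = b \<or> (a, b) \<in> r \<or> (b, a) \<in> r"
    using assms(2,3) by (auto simp: total_on_def)
  then show thesis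
    using that by (auto simp: underS_def)
qed

lemma underS_trans:
  assumes "Well_order r" "a \<in> underS r b" "b \<in> underS r c"
  shows "a \<in> underS r c"
proof -
  have "trans r" "antisym r"
    using assms(1) by (auto simp: order_on_defs well_order_on_def)
  moreover have "(a, b) \<in> r" "(b, c) \<in> r" "b \<noteq> c"
    using assms(2,3) by (auto simp: underS_def)
  ultimately have "(a, c) \<in> r" "a \<noteq> c"
    by (auto dest: transD antisymD)
  then show ?thesis
    by (simp add: underS_def)
qed

lemma aboveS_iff_underS: "b \<in> aboveS r a \<longleftrightarrow> a \<in> underS r b"
  by (auto simp: aboveS_def underS_def)

lemma underS_in_Field:
  assumes "a \<in> underS r b"
  shows "a \<in> Field r" "b \<in> Field r"
  using assms by (auto simp: underS_def Field_def)

lemma Well_order_least: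
  assumes "Well_order r" "a \<in> A"
  obtains m where "m \<in> A" "\<And>b. b \<in> underS r m \<Longrightarrow> b \<notin> A"
proof -
  have "wf (r - Id)"
    using assms(1) by (simp add: well_order_on_def)
  then obtain m where "m \<in> A" "\<And>b. (b, m) \<in> r - Id \<Longrightarrow> b \<notin> A"
    using assms(2) by (rule wfE_min) blast
  then show thesis
    using that by (auto simp: underS_def)
qed

lemma openin_rel_order_topology_rays:
  assumes "a \<in> Field r"
  shows "openin (rel_order_topology r) (underS r a)" "openin (rel_order_topology r) (aboveS r a)"
  using assms unfolding rel_order_topology_def by (auto intro!: topology_generated_by_Basis)

text \<open>
  A subbasic neighbourhood of \<open>t\<close> that is not an upper ray contains everything below \<open>t\<close>, and
  an intersection of two neighbourhoods gets the larger of the two lower bounds. Some element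
  below \<open>t\<close> is required because neighbourhoods such as \<open>Field r\<close> give no bound themselves.
\<close>

lemma openin_rel_order_topology_lower_interval:
  assumes wo: "Well_order r" and "openin (rel_order_topology r) U"
    and "t \<in> U" and "underS r t \<noteq> {}"
  obtains c where "c \<in> underS r t" "underS r t \<inter> aboveS r c \<subseteq> U"
proof -
  have "generate_topology_on (insert (Field r) (underS r ` Field r \<union> aboveS r ` Field r)) U"
    using assms(2) by (simp add: rel_order_topology_def openin_topology_generated_by_iff)
  then have "t \<in> U \<longrightarrow> (\<exists>c\<in>underS r t. underS r t \<inter> aboveS r c \<subseteq> U)"
  proof induction
    case (Int A B)
    show ?case
    proof
      assume "t \<in> A \<inter> B"
      then have "t \<in> A" "t \<in> B"
        by auto
      then obtain a b where a: "a \<in> underS r t" "underS r t \<inter> aboveS r a \<subseteq> A"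
        and b: "b \<in> underS r t" "underS r t \<inter> aboveS r b \<subseteq> B"
        using Int.IH by (elim impE bexE)
      show "\<exists>c\<in>underS r t. underS r t \<inter> aboveS r c \<subseteq> A \<inter> B"
      proof (rule Well_order_cases[OF wo underS_in_Field(1)[OF a(1)] underS_in_Field(1)[OF b(1)]])
        assume "a \<in> underS r b"
        then have "aboveS r b \<subseteq> aboveS r a"
          using underS_trans[OF wo] by (auto simp: aboveS_iff_underS)
        then show ?thesis using a b by blast
      next
        assume "a = b"
        then show ?thesis using a b by blast
      next
        assume "b \<in> underS r a"
        then have "aboveS r a \<subseteq> aboveS r b"
          using underS_trans[OF wo] by (auto simp: aboveS_iff_underS)
        then show ?thesis using a b by blast
      qed
    qed
  next
    case (UN K)
    show ?case
    proof
      assume "t \<in> \<Union>K"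
      then obtain A where A: "A \<in> K" "t \<in> A" ..
      with UN.IH obtain c where "c \<in> underS r t" "underS r t \<inter> aboveS r c \<subseteq> A"
        by metis
      with A(1) show "\<exists>c\<in>underS r t. underS r t \<inter> aboveS r c \<subseteq> \<Union>K"
        by (meson Sup_upper order_trans)
    qed
  next
    case (Basis U)
    then consider "U = Field r" | a where "U = underS r a" | a where "U = aboveS r a"
      by (elim insertE UnE imageE)
    then show ?case
    proof cases
      case 1
      have "underS r t \<subseteq> Field r"
        by (auto dest: underS_in_Field)
      then show ?thesis
        using 1 assms(4) by auto
    next
      case 2
      then have "t \<in> U \<longrightarrow> underS r t \<subseteq> U"
        by (auto dest: underS_trans[OF wo])
      then show ?thesis
        using assms(4) by auto
    next
      case 3
      then show ?thesis
        by (auto simp: aboveS_iff_underS)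
    qed
  qed simp
  then obtain c where "c \<in> underS r t" "underS r t \<inter> aboveS r c \<subseteq> U"
    using assms(3) by (elim impE bexE)
  then show thesis
    by (rule that)
qed

text \<open>
  At the least \<open>t\<close> with uncountably many predecessors every smaller initial segment is countable.
  So countably many lower bounds of neighbourhoods of \<open>t\<close> leave room for some \<open>d < t\<close> above all
  of them, and \<open>d\<close> lies in all these neighbourhoods.
\<close>

lemma not_metrizable_rel_order_topology:
  assumes wo: "Well_order r" and "uncountable (underS r s)"
  shows "\<not> metrizable_space (rel_order_topology r)"
proof
  assume metr: "metrizable_space (rel_order_topology r)"
  obtain t where t: "uncountable (underS r t)"
    and least: "\<And>b. b \<in> underS r t \<Longrightarrow> countable (underS r b)"
  proof (rule Well_order_least[OF wo, of s "{a. uncountable (underS r a)}"])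
    show "s \<in> {a. uncountable (underS r a)}"
      using assms(2) by simp
  qed simp
  have ne: "underS r t \<noteq> {}"
    using t by auto
  then have tF: "t \<in> topspace (rel_order_topology r)"
    unfolding topspace_rel_order_topology by (auto dest: underS_in_Field)
  have "closedin (rel_order_topology r) {t}"
    using metrizable_imp_t1_space[OF metr] tF by (simp add: t1_space_closedin_singleton)
  then have "gdelta_in (rel_order_topology r) {t}"
    by (rule closed_imp_gdelta_in[OF metr])
  then obtain \<U> where \<U>: "countable \<U>" "\<And>U. U \<in> \<U> \<Longrightarrow> openin (rel_order_topology r) U" "\<Inter>\<U> = {t}"
    unfolding gdelta_in_alt intersection_of_def by blast
  have "\<exists>c\<in>underS r t. underS r t \<inter> aboveS r c \<subseteq> U" if "U \<in> \<U>" for U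
  proof -
    have "t \<in> U"
      using that \<U>(3) by auto
    then show ?thesis
      using openin_rel_order_topology_lower_interval[OF wo \<U>(2)[OF that] _ ne] by metis
  qed
  then obtain c where c: "\<And>U. U \<in> \<U> \<Longrightarrow> c U \<in> underS r t"
    "\<And>U. U \<in> \<U> \<Longrightarrow> underS r t \<inter> aboveS r (c U) \<subseteq> U"
    by metis
  have "countable (\<Union>U\<in>\<U>. insert (c U) (underS r (c U)))"
    using \<U>(1) c(1) least by (intro countable_UN countable_insert least c(1))
  then obtain d where d: "d \<in> underS r t" "d \<notin> (\<Union>U\<in>\<U>. insert (c U) (underS r (c U)))"
    using t by (meson countable_subset subsetI)
  have "d \<in> U" if "U \<in> \<U>" for U
  proof -
    have "c U \<in> underS r d"
    proof (rule Well_order_cases[OF wo underS_in_Field(1)[OF d(1)] underS_in_Field(1)[OF c(1)[OF that]]])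
      assume "d \<in> underS r (c U)"
      with d(2) that show ?thesis by blast
    next
      assume "d = c U"
      with d(2) that show ?thesis by blast
    qed
    then show ?thesis
      using c(2)[OF that] d(1) by (auto simp: aboveS_iff_underS)
  qed
  then have "d = t"
    using \<U>(3) by blast
  with d(1) show False
    by (simp add: underS_def)
qed

section \<open>Step functions\<close>

definition step_function :: "'x \<Rightarrow> 'x \<Rightarrow> 'i rel \<Rightarrow> 'i option \<Rightarrow> 'i \<Rightarrow> 'x" where
  "step_function x y r s = (\<lambda>\<beta>\<in>Field r. if Some \<beta> \<in> underS (ord_succ r) s then y else x)"

lemma Some_underS_ord_succ_Some [simp]:
  "Some a \<in> underS (ord_succ r) (Some b) \<longleftrightarrow> a \<in> underS r b"
  by (auto simp: underS_def ord_succ_def)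

lemma underS_ord_succ_None: "underS (ord_succ r) None = Some ` Field r"
  by (auto simp: underS_def ord_succ_def)

lemma underS_ord_succ_E:
  assumes "u \<in> underS (ord_succ r) s"
  obtains \<beta> where "u = Some \<beta>" "\<beta> \<in> Field r"
  using assms by (auto simp: underS_def ord_succ_def Field_def)

lemma Some_underS_ord_succ_in_Field:
  assumes "Some \<beta> \<in> underS (ord_succ r) s"
  shows "\<beta> \<in> Field r"
  using assms by (rule underS_ord_succ_E) simp

lemma step_function_in_mahavier_set:
  assumes wo: "Well_order r" and "x \<in> X" "y \<in> X"
    and "(x, x) \<in> f" "(x, y) \<in> f" "(y, y) \<in> f"
  shows "step_function x y r s \<in> mahavier_set X f r"
proof -
  have "(step_function x y r s \<gamma>, step_function x y r s \<beta>) \<in> f"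
    if "\<gamma> \<in> Field r" "\<beta> \<in> underS r \<gamma>" for \<beta> \<gamma>
  proof -
    have "Some \<beta> \<in> underS (ord_succ r) s" if "Some \<gamma> \<in> underS (ord_succ r) s"
      using underS_trans[OF Well_order_ord_succ[OF wo] _ that, of "Some \<beta>"] \<open>\<beta> \<in> underS r \<gamma>\<close>
      by simp
    then show ?thesis
      using that assms(4-6) underS_in_Field(1)[OF that(2)] by (auto simp: step_function_def)
  qed
  then show ?thesis
    using assms(2,3) by (auto simp: mahavier_set_def step_function_def)
qed

lemma inj_on_step_function:
  assumes wo: "Well_order r" and "x \<noteq> y"
  shows "inj_on (step_function x y r) (Field (ord_succ r))"
proof (rule inj_onI, rule ccontr)
  let ?\<sigma> = "ord_succ r"
  fix s t
  assume st: "s \<in> Field ?\<sigma>" "t \<in> Field ?\<sigma>" "s \<noteq> t"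
    and eq: "step_function x y r s = step_function x y r t"
  (* The smaller of two elements is a coordinate at which their step functions differ. *)
  have neq: "step_function x y r u \<noteq> step_function x y r v" if uv: "u \<in> underS ?\<sigma> v" for u v
  proof -
    obtain \<beta> where \<beta>: "u = Some \<beta>" "\<beta> \<in> Field r"
      using underS_ord_succ_E[OF uv] .
    have "step_function x y r u \<beta> \<noteq> step_function x y r v \<beta>"
      using uv \<beta> \<open>x \<noteq> y\<close> by (auto simp: step_function_def underS_notIn)
    then show ?thesis by metis
  qed
  show False
    by (rule Well_order_cases[OF Well_order_ord_succ[OF wo] st(1,2)])
      (use neq[of s t] neq[of t s] eq st(3) in simp_all)
qed

text \<open>
  The complement of the ray above \<open>Some \<beta>\<close> is a lower ray: its upper bound is the least
  element above \<open>Some \<beta>\<close>, which exists because \<open>None\<close> lies above.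
\<close>

lemma openin_under_ord_succ:
  assumes wo: "Well_order r" and \<beta>: "\<beta> \<in> Field r"
  shows "openin (rel_order_topology (ord_succ r))
           {s \<in> Field (ord_succ r). Some \<beta> \<notin> underS (ord_succ r) s}"
proof -
  let ?\<sigma> = "ord_succ r"
  have wos: "Well_order ?\<sigma>"
    using wo by (rule Well_order_ord_succ)
  have "None \<in> aboveS ?\<sigma> (Some \<beta>)"
    using \<beta> by (simp add: aboveS_iff_underS underS_ord_succ_None)
  then obtain m where m: "m \<in> aboveS ?\<sigma> (Some \<beta>)"
    and least: "\<And>b. b \<in> underS ?\<sigma> m \<Longrightarrow> b \<notin> aboveS ?\<sigma> (Some \<beta>)"
    by (rule Well_order_least[OF wos]) blast
  have \<beta>m: "Some \<beta> \<in> underS ?\<sigma> m"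
    using m by (simp add: aboveS_iff_underS)
  have "{s \<in> Field ?\<sigma>. Some \<beta> \<notin> underS ?\<sigma> s} = underS ?\<sigma> m"
  proof (intro equalityI subsetI)
    fix s
    assume "s \<in> {s \<in> Field ?\<sigma>. Some \<beta> \<notin> underS ?\<sigma> s}"
    then have s: "s \<in> Field ?\<sigma>" "Some \<beta> \<notin> underS ?\<sigma> s"
      by auto
    show "s \<in> underS ?\<sigma> m"
    proof (rule Well_order_cases[OF wos s(1) underS_in_Field(2)[OF \<beta>m]])
      assume "m \<in> underS ?\<sigma> s"
      then show ?thesis
        using s(2) underS_trans[OF wos \<beta>m] by simp
    qed (use s(2) \<beta>m in simp_all)
  next
    fix s
    assume "s \<in> underS ?\<sigma> m"
    then show "s \<in> {s \<in> Field ?\<sigma>. Some \<beta> \<notin> underS ?\<sigma> s}"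
      using least[of s] by (simp add: aboveS_iff_underS underS_in_Field(1))
  qed
  then show ?thesis
    using openin_rel_order_topology_rays(1)[OF underS_in_Field(2)[OF \<beta>m]] by simp
qed

text \<open>
  Each coordinate takes only two values, on the two sides of the cut just above \<open>Some \<beta>\<close>, and
  both sides are open.
\<close>

lemma continuous_map_step_function:
  assumes wo: "Well_order r" and xy: "x \<in> topspace X" "y \<in> topspace X"
  shows "continuous_map (rel_order_topology (ord_succ r)) (product_topology (\<lambda>_. X) (Field r))
           (step_function x y r)"
  unfolding continuous_map_componentwise
proof (intro conjI ballI)
  let ?\<sigma> = "ord_succ r"
  show "step_function x y r ` topspace (rel_order_topology ?\<sigma>) \<subseteq> extensional (Field r)"
    by (auto simp: step_function_def)
  fix \<beta> assume \<beta>: "\<beta> \<in> Field r"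
  have up: "openin (rel_order_topology ?\<sigma>) (aboveS ?\<sigma> (Some \<beta>))"
    using \<beta> by (intro openin_rel_order_topology_rays) (simp add: Field_ord_succ)
  note down = openin_under_ord_succ[OF wo \<beta>]
  show "continuous_map (rel_order_topology ?\<sigma>) X (\<lambda>s. step_function x y r s \<beta>)"
    unfolding continuous_map_def topspace_rel_order_topology
  proof (intro conjI allI impI)
    show "(\<lambda>s. step_function x y r s \<beta>) \<in> Field ?\<sigma> \<rightarrow> topspace X"
      using xy \<beta> by (simp add: step_function_def)
    fix U assume "openin X U"
    have "{s \<in> Field ?\<sigma>. step_function x y r s \<beta> \<in> U} =
        (if y \<in> U then aboveS ?\<sigma> (Some \<beta>) else {}) \<union>
        (if x \<in> U then {s \<in> Field ?\<sigma>. Some \<beta> \<notin> underS ?\<sigma> s} else {})"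
      using \<beta> by (auto simp: step_function_def aboveS_iff_underS dest: underS_in_Field(2) split: if_splits)
    then show "openin (rel_order_topology ?\<sigma>) {s \<in> Field ?\<sigma>. step_function x y r s \<beta> \<in> U}"
      using up down by auto
  qed
qed

text \<open>
  For the continuity of the inverse, the step functions of an upper ray are cut out by one
  coordinate, and those of a lower ray by the union over all coordinates in the ray.
\<close>

lemma step_function_embedding:
  assumes wo: "Well_order r" and "t1_space X"
    and xy: "x \<in> topspace X" "y \<in> topspace X" "x \<noteq> y"
  shows "embedding_map (rel_order_topology (ord_succ r)) (product_topology (\<lambda>_. X) (Field r))
           (step_function x y r)"
proof -
  let ?\<sigma> = "ord_succ r" and ?P = "product_topology (\<lambda>_. X) (Field r)" and ?h = "step_function x y r"
  let ?S = "?h ` Field ?\<sigma>"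
  have wos: "Well_order ?\<sigma>"
    using wo by (rule Well_order_ord_succ)
  have inj: "inj_on ?h (Field ?\<sigma>)"
    using wo \<open>x \<noteq> y\<close> by (rule inj_on_step_function)
  obtain V W where V: "openin X V" "x \<in> V" "y \<notin> V" and W: "openin X W" "y \<in> W" "x \<notin> W"
    using \<open>t1_space X\<close> xy unfolding t1_space_def by metis
  have S: "?S \<subseteq> topspace ?P"
    using xy by (auto simp: step_function_def)
  have coord: "openin (subtopology ?P ?S) {p \<in> ?S. p \<beta> \<in> U}" if "openin X U" "\<beta> \<in> Field r" for U \<beta>
  proof -
    have "openin ?P {p \<in> topspace ?P. p \<beta> \<in> U}"
      using that by (intro openin_continuous_map_preimage[OF continuous_map_product_projection]) auto
    moreover have "{p \<in> ?S. p \<beta> \<in> U} = {p \<in> topspace ?P. p \<beta> \<in> U} \<inter> ?S"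
      using S by blast
    ultimately show ?thesis
      by (auto simp: openin_subtopology)
  qed
  have above: "openin (subtopology ?P ?S) (?h ` aboveS ?\<sigma> t)" if "t \<in> Field ?\<sigma>" for t
  proof (cases t)
    case None
    then have "aboveS ?\<sigma> t = {}"
      by (auto simp: aboveS_def ord_succ_def)
    then show ?thesis by simp
  next
    case (Some \<beta>)
    then have \<beta>: "\<beta> \<in> Field r"
      using that by (auto simp: Field_ord_succ)
    have "?h s \<beta> \<in> W \<longleftrightarrow> s \<in> aboveS ?\<sigma> t" for s
      using \<beta> W Some by (simp add: step_function_def aboveS_iff_underS)
    moreover have "aboveS ?\<sigma> t \<subseteq> Field ?\<sigma>"
      by (auto simp: aboveS_iff_underS dest: underS_in_Field)
    ultimately have "?h ` aboveS ?\<sigma> t = {p \<in> ?S. p \<beta> \<in> W}"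
      by blast
    then show ?thesis
      using coord[OF W(1) \<beta>] by simp
  qed
  have under: "openin (subtopology ?P ?S) (?h ` underS ?\<sigma> t)" for t
  proof -
    have "?h ` underS ?\<sigma> t = (\<Union>\<beta>\<in>{\<beta>. Some \<beta> \<in> underS ?\<sigma> t}. {p \<in> ?S. p \<beta> \<in> V})"
    proof (intro equalityI subsetI)
      fix p
      assume "p \<in> ?h ` underS ?\<sigma> t"
      then obtain s where s: "s \<in> underS ?\<sigma> t" "p = ?h s"
        by blast
      obtain \<beta> where \<beta>: "s = Some \<beta>" "\<beta> \<in> Field r"
        using underS_ord_succ_E[OF s(1)] .
      then have "p \<beta> \<in> V"
        using s V by (simp add: step_function_def underS_notIn)
      then show "p \<in> (\<Union>\<beta>\<in>{\<beta>. Some \<beta> \<in> underS ?\<sigma> t}. {p \<in> ?S. p \<beta> \<in> V})"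
        using s \<beta>(1) underS_in_Field(1)[OF s(1)] by auto
    next
      fix p
      assume "p \<in> (\<Union>\<beta>\<in>{\<beta>. Some \<beta> \<in> underS ?\<sigma> t}. {p \<in> ?S. p \<beta> \<in> V})"
      then obtain \<beta> s where \<beta>: "Some \<beta> \<in> underS ?\<sigma> t" and s: "s \<in> Field ?\<sigma>" "p = ?h s" "p \<beta> \<in> V"
        by blast
      have "\<beta> \<in> Field r"
        using \<beta> by (rule Some_underS_ord_succ_in_Field)
      then have s\<beta>: "Some \<beta> \<notin> underS ?\<sigma> s"
        using s V by (auto simp: step_function_def)
      have "s \<in> underS ?\<sigma> t"
        by (rule Well_order_cases[OF wos s(1) underS_in_Field(1)[OF \<beta>]])
          (use \<beta> s\<beta> underS_trans[OF wos _ \<beta>] in simp_all)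
      then show "p \<in> ?h ` underS ?\<sigma> t"
        using s(2) by blast
    qed
    moreover have "\<beta> \<in> Field r" if "Some \<beta> \<in> underS ?\<sigma> t" for \<beta>
      using that by (rule Some_underS_ord_succ_in_Field)
    ultimately show ?thesis
      using coord[OF V(1)] by (auto intro!: openin_Union)
  qed
  let ?\<B> = "insert (Field ?\<sigma>) (underS ?\<sigma> ` Field ?\<sigma> \<union> aboveS ?\<sigma> ` Field ?\<sigma>)"
  have TS: "topspace (subtopology ?P ?S) = ?S"
    using S by (rule topspace_subtopology_subset)
  have img: "openin (subtopology ?P ?S) (?h ` U)" if "U \<in> ?\<B>" for U
    using that
  proof (elim insertE UnE imageE)
    show "openin (subtopology ?P ?S) (?h ` U)" if "U = Field ?\<sigma>"
      using openin_topspace[of "subtopology ?P ?S"] unfolding TS that .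
  qed (use above under in simp_all)
  let ?g = "inv_into (Field ?\<sigma>) ?h"
  have gh: "?g (?h s) = s" if "s \<in> Field ?\<sigma>" for s
    using inj that by (rule inv_into_f_f)
  have "continuous_map (subtopology ?P ?S) (rel_order_topology ?\<sigma>) ?g"
    unfolding rel_order_topology_def
  proof (rule continuous_on_generated_topo)
    fix U
    assume U: "U \<in> ?\<B>"
    then have "U \<subseteq> Field ?\<sigma>"
      by (auto simp: aboveS_iff_underS dest: underS_in_Field)
    then have "?g -` U \<inter> ?S = ?h ` U"
      using gh by (fastforce simp: subset_iff)
    then show "openin (subtopology ?P ?S) (?g -` U \<inter> topspace (subtopology ?P ?S))"
      using img[OF U] unfolding TS by simp
  next
    have "?g ` ?S \<subseteq> Field ?\<sigma>"
      using gh by auto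
    then show "?g ` topspace (subtopology ?P ?S) \<subseteq> \<Union> ?\<B>"
      unfolding TS by blast
  qed
  moreover have "continuous_map (rel_order_topology ?\<sigma>) (subtopology ?P ?S) ?h"
    using continuous_map_step_function[OF wo xy(1,2)]
    by (auto simp: continuous_map_in_subtopology topspace_rel_order_topology)
  ultimately have "homeomorphic_maps (rel_order_topology ?\<sigma>) (subtopology ?P ?S) ?h ?g"
    unfolding homeomorphic_maps_def TS topspace_rel_order_topology using gh by auto
  then show ?thesis
    unfolding embedding_map_def topspace_rel_order_topology by (rule homeomorphic_maps_imp_map)
qed

theorem theorem26:
  fixes X :: "'x topology" and f :: "'x rel" and \<alpha> :: "'i rel"
  assumes "t1_space X"
    and "Well_order \<alpha>"
    and "uncountable (Field \<alpha>)"
    and "f \<subseteq> topspace X \<times> topspace X"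
    and "f \<subseteq> f O f"
    and "condition_Gamma (topspace X) f"
  shows "(\<exists>S \<subseteq> topspace (mahavier_product X f \<alpha>).
            subtopology (mahavier_product X f \<alpha>) S
              homeomorphic_space rel_order_topology (ord_succ \<alpha>))
       \<and> \<not> metrizable_space (mahavier_product X f \<alpha>)"
proof -
  obtain x y where xy: "x \<in> topspace X" "y \<in> topspace X" "x \<noteq> y"
    and f: "(x, x) \<in> f" "(x, y) \<in> f" "(y, y) \<in> f"
    using assms(6) unfolding condition_Gamma_def by blast
  let ?S = "step_function x y \<alpha> ` Field (ord_succ \<alpha>)"
  have S: "?S \<subseteq> mahavier_set (topspace X) f \<alpha>"
    by (intro image_subsetI step_function_in_mahavier_set[OF assms(2) xy(1,2) f])
  have "rel_order_topology (ord_succ \<alpha>) homeomorphic_space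
      subtopology (product_topology (\<lambda>_. X) (Field \<alpha>)) ?S"
    using embedding_map_imp_homeomorphic_space[OF step_function_embedding[OF assms(2,1) xy]]
    by (simp only: topspace_rel_order_topology)
  then have hom: "subtopology (mahavier_product X f \<alpha>) ?S
      homeomorphic_space rel_order_topology (ord_succ \<alpha>)"
    unfolding mahavier_product_def subtopology_subtopology Int_absorb1[OF S]
    by (rule homeomorphic_space_sym[THEN iffD1])
  have "uncountable (underS (ord_succ \<alpha>) None)"
    using assms(3) by (simp add: underS_ord_succ_None countable_image_inj_eq)
  then have "\<not> metrizable_space (rel_order_topology (ord_succ \<alpha>))"
    by (rule not_metrizable_rel_order_topology[OF Well_order_ord_succ[OF assms(2)]])
  then have "\<not> metrizable_space (mahavier_product X f \<alpha>)"
    using homeomorphic_metrizable_space[OF hom] metrizable_space_subtopology by blast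
  then show ?thesis
    using hom S unfolding topspace_mahavier_product by blast
qed

end
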